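(* Let $G$ be a graph with $m=|E(G)|$ edges, let $k=d(s,r)$ be the distance between $s$ and $r$ in $G$, and for each $i$ let $d_i$ be the number of $s,r$-paths of length $i$ in $G$. Let $A_0$ be a protocol for which there is $\varepsilon>0$ with $\hat\rho(G,p)=\rho_{A_0}(G,p)$ for all $p\in(0,\varepsilon)$. Then $A_0\supseteq A^{(k+1)}$, and $\hat\rho(G,p)=\rho_{A_0}(G,p)$ for all $p<3^{-m}$, where $\rho_{A_0}(G,p)=d_kp^k+d_{k+1}p^{k+1}+O(p^{k+2})$ as $p\to 0$.
   Context: Graphs are finite, undirected, simple, with distinguished sender $s$ and receiver $r$. Each edge survives independently with the same probability $p\in(0,1)$. An instruction is a triple $uvw$ with $u,w$ distinct neighbors of $v$; a protocol $A$ is a set of instructions; a walk contains $uvw$ if $u,v,w$ occur consecutively in it; an $A$-walk is an $s,r$-walk all of whose contained instructions lie in $A$; $A$ is finite if there are finitely many $A$-walks; $\rho_A(G,p)$ is the probability that all edges of some $A$-walk survive; $\hat\rho(G,p)=\max\{\rho_A(G,p):A$ finite protocol$\}$. For an integer $\ell$, $A^{(\ell)}$ denotes the set of instructions $uvw$ contained in some $s,r$-path of length at most $\ell$. *)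

theory Defs
  imports
    "HOL-Probability.Probability"
    "HOL-Library.Extended_Nat"
    "HOL-Library.Landau_Symbols"
    "HOL-Library.Sublist"
begin

definition simple_graph :: "'a set \<Rightarrow> 'a set set \<Rightarrow> bool" where
  "simple_graph V E \<longleftrightarrow> finite V \<and> (\<forall>e\<in>E. e \<subseteq> V \<and> card e = 2)"

(* Walks are given by their nonempty vertex lists; a list xs has length xs - 1 edges. *)
definition walks :: "'a set \<Rightarrow> 'a set set \<Rightarrow> 'a \<Rightarrow> 'a \<Rightarrow> 'a list set" where
  "walks V E s r =
     {xs. xs \<noteq> [] \<and> set xs \<subseteq> V \<and> successively (\<lambda>u v. {u, v} \<in> E) xs \<and> hd xs = s \<and> last xs = r}"

definition paths :: "'a set \<Rightarrow> 'a set set \<Rightarrow> 'a \<Rightarrow> 'a \<Rightarrow> 'a list set" where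
  "paths V E s r = {xs \<in> walks V E s r. distinct xs}"

definition walk_length :: "'a list \<Rightarrow> nat" where
  "walk_length xs = length xs - 1"

definition walk_edges :: "'a list \<Rightarrow> 'a set set" where
  "walk_edges xs = {{u, v} |u v. sublist [u, v] xs}"

(* Infinite if there is no s,r-path. *)
definition graph_dist :: "'a set \<Rightarrow> 'a set set \<Rightarrow> 'a \<Rightarrow> 'a \<Rightarrow> enat" where
  "graph_dist V E s r = (INF xs\<in>paths V E s r. enat (walk_length xs))"

definition num_paths :: "'a set \<Rightarrow> 'a set set \<Rightarrow> 'a \<Rightarrow> 'a \<Rightarrow> nat \<Rightarrow> nat" where
  "num_paths V E s r i = card {xs \<in> paths V E s r. walk_length xs = i}"

definition instructions :: "'a set set \<Rightarrow> ('a \<times> 'a \<times> 'a) set" where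
  "instructions E = {(u, v, w). {u, v} \<in> E \<and> {v, w} \<in> E \<and> u \<noteq> w}"

definition protocol :: "'a set set \<Rightarrow> ('a \<times> 'a \<times> 'a) set \<Rightarrow> bool" where
  "protocol E A \<longleftrightarrow> A \<subseteq> instructions E"

definition triples :: "'a list \<Rightarrow> ('a \<times> 'a \<times> 'a) set" where
  "triples xs = {(u, v, w). sublist [u, v, w] xs}"

(* Every consecutive triple has to lie in A. Since a protocol contains no triple (u, v, u),
   such walks never turn back along the edge just used. *)
definition protocol_walks ::
  "'a set \<Rightarrow> 'a set set \<Rightarrow> 'a \<Rightarrow> 'a \<Rightarrow> ('a \<times> 'a \<times> 'a) set \<Rightarrow> 'a list set" where
  "protocol_walks V E s r A = {xs \<in> walks V E s r. triples xs \<subseteq> A}"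

definition finite_protocol ::
  "'a set \<Rightarrow> 'a set set \<Rightarrow> 'a \<Rightarrow> 'a \<Rightarrow> ('a \<times> 'a \<times> 'a) set \<Rightarrow> bool" where
  "finite_protocol V E s r A \<longleftrightarrow> protocol E A \<and> finite (protocol_walks V E s r A)"

(* A sample point S tells for each edge whether it survives. *)
definition survival_pmf :: "'a set set \<Rightarrow> real \<Rightarrow> ('a set \<Rightarrow> bool) pmf" where
  "survival_pmf E p = Pi_pmf E False (\<lambda>_. bernoulli_pmf p)"

definition rho ::
  "'a set \<Rightarrow> 'a set set \<Rightarrow> 'a \<Rightarrow> 'a \<Rightarrow> ('a \<times> 'a \<times> 'a) set \<Rightarrow> real \<Rightarrow> real" where
  "rho V E s r A p =
     measure_pmf.prob (survival_pmf E p)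
       {S. \<exists>xs\<in>protocol_walks V E s r A. \<forall>e\<in>walk_edges xs. S e}"

(* The maximum ranges over a finite nonempty set: there are finitely many protocols,
   and the empty protocol is finite. *)
definition rho_hat :: "'a set \<Rightarrow> 'a set set \<Rightarrow> 'a \<Rightarrow> 'a \<Rightarrow> real \<Rightarrow> real" where
  "rho_hat V E s r p = Max {rho V E s r A p |A. finite_protocol V E s r A}"

definition path_protocol ::
  "'a set \<Rightarrow> 'a set set \<Rightarrow> 'a \<Rightarrow> 'a \<Rightarrow> nat \<Rightarrow> ('a \<times> 'a \<times> 'a) set" where
  "path_protocol V E s r l = (\<Union>xs\<in>{xs \<in> paths V E s r. walk_length xs \<le> l}. triples xs)"

end

theory Submission
  imports Defs
begin

text \<open>Let \<open>N\<^sub>i(A)\<close> be the number of edge sets of size \<open>i\<close> that contain all edges of some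
  \<open>A\<close>-walk. Then \<open>\<rho>\<^sub>A(p)\<close> is the sum of the \<open>N\<^sub>i(A) p^i (1 - p)^(m - i)\<close>. As \<open>N\<^sub>i(A)\<close> is at most
  \<open>m choose i\<close>, the sign of \<open>\<rho>\<^sub>A - \<rho>\<^sub>B\<close> on the whole of \<open>(0, 2^(-m))\<close> is that of its first nonzero
  coefficient. Hence optimality at a single point of this interval implies optimality everywhere in it.
  An edge set of size at most \<open>k + 1\<close> that connects \<open>s\<close> and \<open>r\<close> contains a path of length at most
  \<open>k + 1\<close>, so the protocol \<open>B\<close> of all those paths maximises \<open>N\<^sub>i\<close> for \<open>i \<le> k + 1\<close>. It is finite,
  so an optimal \<open>A\<^sub>0\<close> has the same \<open>N\<^sub>i\<close> for these \<open>i\<close>. Since a walk without U-turns inside a path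
  is that path, \<open>A\<^sub>0\<close> contains all instructions of \<open>B\<close>. Finally \<open>N\<^sub>k = d\<^sub>k\<close> and
  \<open>N\<^sub>k\<^sub>+\<^sub>1 = d\<^sub>k (m - k) + d\<^sub>k\<^sub>+\<^sub>1\<close>, because two distinct shortest paths differ in at least two edges.\<close>

section \<open>Consecutive vertices by index\<close>

lemma sublist2_conv_nth: "sublist [u, v] xs \<longleftrightarrow> (\<exists>i. Suc i < length xs \<and> xs ! i = u \<and> xs ! Suc i = v)"
proof
  assume "sublist [u, v] xs"
  then obtain ps ss where xs: "xs = ps @ [u, v] @ ss"
    unfolding sublist_def by blast
  then have "xs ! length ps = u" "xs ! Suc (length ps) = v" "Suc (length ps) < length xs"
    by (simp_all add: nth_append)
  then show "\<exists>i. Suc i < length xs \<and> xs ! i = u \<and> xs ! Suc i = v" by blast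
next
  assume "\<exists>i. Suc i < length xs \<and> xs ! i = u \<and> xs ! Suc i = v"
  then obtain i where "Suc i < length xs" "xs ! i = u" "xs ! Suc i = v" by blast
  then have "xs = take i xs @ [u, v] @ drop (Suc (Suc i)) xs"
    using id_take_nth_drop[of i xs] Cons_nth_drop_Suc[of "Suc i" xs] by simp
  then show "sublist [u, v] xs"
    unfolding sublist_def by blast
qed

lemma sublist3_conv_nth:
  "sublist [u, v, w] xs \<longleftrightarrow>
     (\<exists>i. Suc (Suc i) < length xs \<and> xs ! i = u \<and> xs ! Suc i = v \<and> xs ! Suc (Suc i) = w)"
proof
  assume "sublist [u, v, w] xs"
  then obtain ps ss where xs: "xs = ps @ [u, v, w] @ ss"
    unfolding sublist_def by blast
  then have "xs ! length ps = u" "xs ! Suc (length ps) = v" "xs ! Suc (Suc (length ps)) = w"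
    "Suc (Suc (length ps)) < length xs"
    by (simp_all add: nth_append)
  then show "\<exists>i. Suc (Suc i) < length xs \<and> xs ! i = u \<and> xs ! Suc i = v \<and> xs ! Suc (Suc i) = w"
    by blast
next
  assume "\<exists>i. Suc (Suc i) < length xs \<and> xs ! i = u \<and> xs ! Suc i = v \<and> xs ! Suc (Suc i) = w"
  then obtain i where "Suc (Suc i) < length xs" "xs ! i = u" "xs ! Suc i = v" "xs ! Suc (Suc i) = w"
    by blast
  then have "xs = take i xs @ [u, v, w] @ drop (Suc (Suc (Suc i))) xs"
    using id_take_nth_drop[of i xs] Cons_nth_drop_Suc[of "Suc i" xs]
      Cons_nth_drop_Suc[of "Suc (Suc i)" xs] by simp
  then show "sublist [u, v, w] xs"
    unfolding sublist_def by blast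
qed

lemma walk_edges_conv_nth: "walk_edges xs = (\<lambda>i. {xs ! i, xs ! Suc i}) ` {..<walk_length xs}"
  unfolding walk_edges_def sublist2_conv_nth walk_length_def
  by (auto simp: image_iff less_diff_conv) blast

lemma triples_conv_nth:
  "triples xs = {(xs ! i, xs ! Suc i, xs ! Suc (Suc i)) |i. Suc (Suc i) < length xs}"
  unfolding triples_def sublist3_conv_nth by auto

lemma finite_walk_edges: "finite (walk_edges xs)"
  by (simp add: walk_edges_conv_nth)

lemma walk_edges_iff_successively:
  "walk_edges xs \<subseteq> F \<longleftrightarrow> successively (\<lambda>u v. {u, v} \<in> F) xs"
  unfolding walk_edges_conv_nth walk_length_def successively_conv_nth
  by (auto simp: image_subset_iff less_diff_conv)

lemma walk_edges_subset: "xs \<in> walks V E s r \<Longrightarrow> walk_edges xs \<subseteq> E"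
  by (simp add: walk_edges_iff_successively walks_def)

lemma finite_instructions:
  assumes "simple_graph V E"
  shows "finite (instructions E)"
proof (rule finite_subset)
  show "instructions E \<subseteq> V \<times> V \<times> V"
    using assms by (fastforce simp: instructions_def simple_graph_def)
  show "finite (V \<times> V \<times> V)"
    using assms by (simp add: simple_graph_def)
qed

lemma finite_graph_edges: "simple_graph V E \<Longrightarrow> finite E"
  by (rule finite_subset[of E "Pow V"]) (auto simp: simple_graph_def)

section \<open>Paths inside walks, and walks inside paths\<close>

text \<open>Cutting out the stretch between two visits to the same vertex shortens a walk and uses
  no new edge; repeating this ends in a path.\<close>

lemma walk_contains_path:
  assumes "xs \<in> walks V E s r"
  shows "\<exists>ys\<in>paths V E s r. walk_edges ys \<subseteq> walk_edges xs \<and> walk_length ys \<le> walk_length xs"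
  using assms
proof (induction "length xs" arbitrary: xs rule: less_induct)
  case less
  show ?case
  proof (cases "distinct xs")
    case True
    then show ?thesis using less.prems by (auto simp: paths_def)
  next
    case False
    then obtain a b c x where xs: "xs = a @ [x] @ b @ [x] @ c"
      using not_distinct_decomp by blast
    define zs where "zs = a @ [x] @ c"
    have shortcut: "successively P zs" if "successively P xs" for P
      using that successively_append_iff[of P "a @ [x] @ b" "[x] @ c"]
      by (auto simp: xs zs_def successively_append_iff)
    \<comment> \<open>\<open>shortcut\<close> works for any relation on consecutive vertices, so it
      serves for \<open>walk_edges xs\<close> here and for \<open>E\<close> below.\<close>
    have "successively (\<lambda>u v. {u, v} \<in> walk_edges xs) xs"
      using walk_edges_iff_successively by blast
    then have sub: "walk_edges zs \<subseteq> walk_edges xs"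
      using shortcut by (simp add: walk_edges_iff_successively)
    have "zs \<in> walks V E s r"
      using less.prems shortcut by (auto simp: walks_def xs zs_def hd_append)
    moreover have "length zs < length xs" by (simp add: xs zs_def)
    ultimately obtain ys where "ys \<in> paths V E s r" "walk_edges ys \<subseteq> walk_edges zs"
      "walk_length ys \<le> walk_length zs"
      using less.hyps by blast
    then show ?thesis
      using sub \<open>length zs < length xs\<close>
      by (intro bexI[of _ ys]) (auto simp: walk_length_def)
  qed
qed

lemma inj_on_path_edges:
  assumes "distinct xs"
  shows "inj_on (\<lambda>i. {xs ! i, xs ! Suc i}) {..<walk_length xs}"
proof (rule inj_onI)
  fix i j
  assume "i \<in> {..<walk_length xs}" "j \<in> {..<walk_length xs}"
    and eq: "{xs ! i, xs ! Suc i} = {xs ! j, xs ! Suc j}"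
  then have "Suc i < length xs" "Suc j < length xs" by (auto simp: walk_length_def)
  \<comment> \<open>The crossed match would need both \<open>i = Suc j\<close> and
    \<open>j = Suc i\<close>.\<close>
  then show "i = j"
    using eq assms by (auto simp: doubleton_eq_iff nth_eq_iff_index_eq)
qed

lemma card_path_edges: "distinct xs \<Longrightarrow> card (walk_edges xs) = walk_length xs"
  unfolding walk_edges_conv_nth by (simp add: card_image inj_on_path_edges)

text \<open>The edges of a path form a line, on which a walk from \<open>s\<close> can only advance
  or reverse, and instructions forbid reversing. So the walk agrees with the path vertex by vertex,
  and it can end in \<open>r\<close> only at the far end, since the path meets \<open>r\<close>
  nowhere else.\<close>

lemma walk_within_path:
  assumes xs: "xs \<in> paths V E s r"
    and ys: "ys \<in> walks V E s r" "triples ys \<subseteq> instructions E"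
    and sub: "walk_edges ys \<subseteq> walk_edges xs"
  shows "ys = xs"
proof -
  have d: "distinct xs" and ne: "xs \<noteq> []" "ys \<noteq> []"
    and hd: "xs ! 0 = s" "ys ! 0 = s" and last: "last xs = r" "last ys = r"
    using xs ys by (auto simp: paths_def walks_def hd_conv_nth)
  have step: "\<exists>j. Suc j < length xs \<and> {ys ! i, ys ! Suc i} = {xs ! j, xs ! Suc j}"
    if "Suc i < length ys" for i
  proof -
    have "{ys ! i, ys ! Suc i} \<in> walk_edges ys"
      using that by (simp add: walk_edges_conv_nth walk_length_def less_diff_conv)
    then have "{ys ! i, ys ! Suc i} \<in> walk_edges xs" using sub by blast
    then show ?thesis by (auto simp: walk_edges_conv_nth walk_length_def less_diff_conv)
  qed
  have follow: "i < length xs \<and> ys ! i = xs ! i" if "i < length ys" for i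
    using that
  proof (induction i rule: less_induct)
    case (less i)
    show ?case
    proof (cases i)
      case 0
      then show ?thesis using ne hd by simp
    next
      case (Suc i')
      have pre: "i' < length xs" "ys ! i' = xs ! i'"
        using less Suc by auto
      obtain j where j: "Suc j < length xs" "{ys ! i', ys ! i} = {xs ! j, xs ! Suc j}"
        using step less.prems Suc by blast
      then consider "xs ! i' = xs ! j" "ys ! i = xs ! Suc j"
        | "xs ! i' = xs ! Suc j" "ys ! i = xs ! j"
        using pre by (auto simp: doubleton_eq_iff)
      then show ?thesis
      proof cases
        case 1
        then have "i' = j" using d pre j by (simp add: nth_eq_iff_index_eq)
        then show ?thesis using 1 j Suc by simp
      next
        case 2
        then have i': "i' = Suc j" using d pre j by (simp add: nth_eq_iff_index_eq)
        \<comment> \<open>Stepping back would give a triple that starts and ends in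
          \<open>xs ! j\<close>.\<close>
        then have "ys ! j = xs ! j" using less.IH less.prems Suc by simp
        moreover have "(ys ! j, ys ! Suc j, ys ! Suc (Suc j)) \<in> instructions E"
          using ys(2) less.prems Suc i' unfolding triples_conv_nth by blast
        ultimately show ?thesis using 2 i' Suc by (simp add: instructions_def)
      qed
    qed
  qed
  have "length ys - 1 < length xs" "ys ! (length ys - 1) = xs ! (length ys - 1)"
    using follow[of "length ys - 1"] ne by auto
  moreover have "ys ! (length ys - 1) = xs ! (length xs - 1)"
    using last ne by (simp add: last_conv_nth)
  ultimately have "length ys - 1 = length xs - 1"
    using d ne by (simp add: nth_eq_iff_index_eq)
  then have "length ys = length xs"
    using ne by (metis One_nat_def Suc_pred length_greater_0_conv)
  then show ?thesis using follow by (simp add: nth_equalityI)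
qed

lemma walk_triples_edges:
  assumes "xs \<in> walks V E s r" "(u, v, w) \<in> triples xs"
  shows "{u, v} \<in> E" "{v, w} \<in> E"
  using assms unfolding triples_conv_nth walks_def successively_conv_nth by auto

lemma path_triples:
  assumes "xs \<in> paths V E s r"
  shows "triples xs \<subseteq> instructions E"
proof
  fix t assume t: "t \<in> triples xs"
  then obtain i where i: "Suc (Suc i) < length xs" "t = (xs ! i, xs ! Suc i, xs ! Suc (Suc i))"
    unfolding triples_conv_nth by blast
  have "xs ! i \<noteq> xs ! Suc (Suc i)"
    using i assms by (simp add: paths_def nth_eq_iff_index_eq)
  then show "t \<in> instructions E"
    using walk_triples_edges[of xs V E s r] assms t i by (auto simp: instructions_def paths_def)
qed

lemma path_edges_subset_imp_eq:
  assumes "xs \<in> paths V E s r" "ys \<in> paths V E s r" "walk_edges ys \<subseteq> walk_edges xs"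
  shows "ys = xs"
  using walk_within_path[OF assms(1) _ path_triples[OF assms(2)]] assms by (auto simp: paths_def)

section \<open>Distance from the sender\<close>

text \<open>Walks rather than paths, so that appending an edge stays inside the set. An unreachable
  vertex gets the default \<open>Inf {} = 0\<close>.\<close>

definition hop_dist :: "'a set \<Rightarrow> 'a set set \<Rightarrow> 'a \<Rightarrow> 'a \<Rightarrow> nat" where
  "hop_dist V E s v = Inf (walk_length ` walks V E s v)"

lemma hop_dist_sender: "s \<in> V \<Longrightarrow> hop_dist V E s s = 0"
  unfolding hop_dist_def
  by (rule cInf_eq_minimum[OF image_eqI[of _ _ "[s]"]]) (auto simp: walks_def walk_length_def)

lemma hop_dist_step:
  assumes "simple_graph V E" "{u, v} \<in> E"
  shows "hop_dist V E s v \<le> Suc (hop_dist V E s u)"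
proof -
  have ext: "xs @ [y] \<in> walks V E s y"
    if "xs \<in> walks V E s x" "{x, y} \<in> E" for xs x y
    using that assms(1) by (auto simp: walks_def successively_append_iff simple_graph_def)
  show ?thesis
  proof (cases "walks V E s u = {}")
    \<comment> \<open>Edges are symmetric, so \<open>v\<close> is unreachable too and both values
      are the default.\<close>
    case True
    have "walks V E s v = {}"
      using ext[of _ v u] assms(2) True by (auto simp: insert_commute)
    then show ?thesis using True by (simp add: hop_dist_def)
  next
    case False
    then obtain xs where xs: "xs \<in> walks V E s u" "walk_length xs = hop_dist V E s u"
      using Inf_nat_def1[of "walk_length ` walks V E s u"] unfolding hop_dist_def by fastforce
    have "hop_dist V E s v \<le> walk_length (xs @ [v])"
      unfolding hop_dist_def using ext[OF xs(1) assms(2)] by (intro cInf_lower) auto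
    also have "\<dots> = Suc (walk_length xs)"
      using xs(1) by (auto simp: walk_length_def walks_def Suc_diff_Suc)
    finally show ?thesis using xs(2) by simp
  qed
qed

text \<open>\<open>graph_dist\<close> minimises over paths and \<open>hop_dist\<close> over walks;
  shortcutting carries the bound over.\<close>

lemma graph_dist_le:
  assumes "graph_dist V E s r = enat k" "xs \<in> walks V E s r"
  shows "k \<le> walk_length xs"
proof -
  obtain ys where "ys \<in> paths V E s r" "walk_length ys \<le> walk_length xs"
    using walk_contains_path[OF assms(2)] by blast
  then have "graph_dist V E s r \<le> enat (walk_length ys)"
    unfolding graph_dist_def by (intro INF_lower)
  then show ?thesis
    using assms(1) \<open>walk_length ys \<le> walk_length xs\<close> by simp
qed

lemma graph_dist_attained:
  assumes "graph_dist V E s r = enat k"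
  obtains xs where "xs \<in> paths V E s r" "walk_length xs = k"
proof -
  \<comment> \<open>The infimum of the empty set in \<open>enat\<close> is infinite.\<close>
  have "(\<lambda>xs. enat (walk_length xs)) ` paths V E s r \<noteq> {}"
    using assms by (auto simp: graph_dist_def top_enat_def)
  then have "graph_dist V E s r \<in> (\<lambda>xs. enat (walk_length xs)) ` paths V E s r"
    unfolding graph_dist_def by (metis Inf_enat_def LeastI ex_in_conv)
  then show ?thesis using assms that by auto
qed

lemma hop_dist_receiver:
  assumes "graph_dist V E s r = enat k"
  shows "hop_dist V E s r = k"
proof -
  obtain xs where "xs \<in> paths V E s r" "walk_length xs = k"
    using graph_dist_attained[OF assms] .
  then show ?thesis
    unfolding hop_dist_def
    by (intro cInf_eq_minimum) (auto simp: paths_def image_iff dest: graph_dist_le[OF assms])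
qed

section \<open>Expansion of the survival probability\<close>

text \<open>\<open>W\<close> is left open so that the walks of a protocol can be compared with those
  of another one and with all paths.\<close>

definition connecting_sets :: "'a set set \<Rightarrow> 'a list set \<Rightarrow> nat \<Rightarrow> 'a set set set" where
  "connecting_sets E W i = {F. F \<subseteq> E \<and> card F = i \<and> (\<exists>xs\<in>W. walk_edges xs \<subseteq> F)}"

lemma finite_connecting_sets: "finite E \<Longrightarrow> finite (connecting_sets E W i)"
  by (rule finite_subset[of _ "Pow E"]) (auto simp: connecting_sets_def)

lemma card_connecting_sets_le:
  assumes "finite E"
  shows "card (connecting_sets E W i) \<le> card E choose i"
proof -
  have "card (connecting_sets E W i) \<le> card {F. F \<subseteq> E \<and> card F = i}"
    using assms by (intro card_mono) (auto simp: connecting_sets_def)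
  then show ?thesis using assms by (simp add: n_subsets)
qed

lemma prob_survival_set:
  assumes "finite E" "0 \<le> p" "p \<le> 1" "F \<subseteq> E"
  shows "pmf (survival_pmf E p) (\<lambda>e. e \<in> F) = p ^ card F * (1 - p) ^ (card E - card F)"
proof -
  have "pmf (survival_pmf E p) (\<lambda>e. e \<in> F) = (\<Prod>e\<in>E. pmf (bernoulli_pmf p) (e \<in> F))"
    unfolding survival_pmf_def using assms by (intro pmf_Pi') auto
  also have "\<dots> = (\<Prod>e\<in>E. if e \<in> F then p else 1 - p)"
    using assms by (intro prod.cong) auto
  also have "\<dots> = p ^ card (E \<inter> F) * (1 - p) ^ card (E - F)"
    using assms by (simp add: prod.If_cases Diff_eq)
  finally show ?thesis
    using assms by (simp add: Int_absorb1 card_Diff_subset finite_subset)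
qed

text \<open>The event depends only on the set of surviving edges; grouping these sets by size leaves
  their counts as coefficients. This also covers infinite \<open>W\<close>, as there are only
  finitely many edge sets.\<close>

lemma prob_walk_survives:
  assumes E: "finite E" and p: "0 \<le> p" "p \<le> 1" and W: "\<And>xs. xs \<in> W \<Longrightarrow> walk_edges xs \<subseteq> E"
  shows "measure_pmf.prob (survival_pmf E p) {S. \<exists>xs\<in>W. \<forall>e\<in>walk_edges xs. S e} =
    (\<Sum>i\<le>card E. real (card (connecting_sets E W i)) * (p ^ i * (1 - p) ^ (card E - i)))"
proof -
  define G where "G = {F. F \<subseteq> E \<and> (\<exists>xs\<in>W. walk_edges xs \<subseteq> F)}"
  define ind where "ind = (\<lambda>F (e :: 'a set). e \<in> F)"
  have finG: "finite G"
    using E by (intro finite_subset[of G "Pow E"]) (auto simp: G_def)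
  have inj: "inj_on ind G"
    by (auto simp: inj_on_def ind_def fun_eq_iff)
  \<comment> \<open>Sample points that are true outside \<open>E\<close> may satisfy the event, but
    they have probability zero; hence the comparison on the support.\<close>
  have supp: "{S. \<exists>xs\<in>W. \<forall>e\<in>walk_edges xs. S e} \<inter> set_pmf (survival_pmf E p) =
    ind ` G \<inter> set_pmf (survival_pmf E p)" (is "?L = ?R")
  proof
    show "?L \<subseteq> ?R"
    proof
      fix S assume S: "S \<in> ?L"
      have "\<forall>e. e \<notin> E \<longrightarrow> \<not> S e"
        using S set_Pi_pmf_subset[OF E, of False "\<lambda>_. bernoulli_pmf p"]
        by (auto simp: survival_pmf_def)
      then have "{e. S e} \<in> G" "S = ind {e. S e}"
        using S by (auto simp: G_def ind_def)
      then show "S \<in> ?R" using S by blast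
    qed
    show "?R \<subseteq> ?L" by (auto simp: G_def ind_def)
  qed
  have "measure_pmf.prob (survival_pmf E p) {S. \<exists>xs\<in>W. \<forall>e\<in>walk_edges xs. S e} =
    measure_pmf.prob (survival_pmf E p) (ind ` G)"
    by (subst (1 2) measure_Int_set_pmf[symmetric]) (simp only: supp)
  also have "\<dots> = (\<Sum>F\<in>G. pmf (survival_pmf E p) (ind F))"
    using finG inj by (simp add: measure_measure_pmf_finite sum.reindex)
  also have "\<dots> = (\<Sum>F\<in>G. p ^ card F * (1 - p) ^ (card E - card F))"
    using E p unfolding ind_def by (intro sum.cong prob_survival_set) (auto simp: G_def)
  also have "\<dots> = (\<Sum>i\<le>card E. \<Sum>F\<in>{F\<in>G. card F = i}. p ^ card F * (1 - p) ^ (card E - card F))"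
  proof (rule sum.group[symmetric])
    show "card ` G \<subseteq> {..card E}" by (auto simp: G_def card_mono E)
  qed (use finG in auto)
  also have "\<dots> = (\<Sum>i\<le>card E. \<Sum>F\<in>connecting_sets E W i. p ^ i * (1 - p) ^ (card E - i))"
    by (intro sum.cong) (auto simp: G_def connecting_sets_def)
  finally show ?thesis by simp
qed

lemma rho_expansion:
  assumes "simple_graph V E" "0 \<le> p" "p \<le> 1"
  shows "rho V E s r A p =
    (\<Sum>i\<le>card E. real (card (connecting_sets E (protocol_walks V E s r A) i)) *
      (p ^ i * (1 - p) ^ (card E - i)))"
  unfolding rho_def using assms finite_graph_edges
  by (intro prob_walk_survives) (auto simp: protocol_walks_def dest: walk_edges_subset)

section \<open>Sign near zero under binomially bounded coefficients\<close>

text \<open>An integer leading coefficient has modulus at least 1, while all later terms together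
  amount to at most \<open>(2 ^ m - 1) * p / (1 - p)\<close> times the weight at \<open>j\<close>.
  This factor is below 1 exactly when \<open>p < 1 / 2 ^ m\<close>.\<close>

lemma sgn_leading_coeff:
  fixes c :: "nat \<Rightarrow> int" and p :: real
  assumes bound: "\<And>i. i \<le> m \<Longrightarrow> \<bar>c i\<bar> \<le> int (m choose i)"
    and j: "j \<le> m" "c j \<noteq> 0" "\<And>i. i < j \<Longrightarrow> c i = 0"
    and p: "0 < p" "p < 1" "p < 1 / 2 ^ m"
  shows "sgn (\<Sum>i\<le>m. of_int (c i) * (p ^ i * (1 - p) ^ (m - i))) = of_int (sgn (c j))"
proof -
  define w where "w = (\<lambda>i. p ^ i * (1 - p) ^ (m - i))"
  have w_pos: "w i > 0" for i using p by (simp add: w_def)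
  \<comment> \<open>The ratio of the weights is a positive power of \<open>p / (1 - p)\<close>, and
    this quotient is at most 1 because \<open>p\<close> is at most 1/2.\<close>
  have tail_w: "(1 - p) * w i \<le> p * w j" if "i \<in> {j<..m}" for i
  proof -
    obtain n where n: "i = Suc (j + n)" using \<open>i \<in> {j<..m}\<close> less_iff_Suc_add[of j i] by auto
    have "(2::real) ^ 1 \<le> 2 ^ m" using that by (intro power_increasing) auto
    then have "1 / 2 ^ m \<le> (1 / 2 :: real)" by (simp add: field_simps)
    then have "p \<le> 1 - p" using p by linarith
    then have pow: "p ^ n \<le> (1 - p) ^ n" using p by (intro power_mono) auto
    have "(1 - p) * w i = p * p ^ j * (1 - p) ^ Suc (m - i) * p ^ n"
      by (simp add: w_def n power_add mult_ac)
    also have "\<dots> \<le> p * p ^ j * (1 - p) ^ Suc (m - i) * (1 - p) ^ n"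
      using p pow by (intro mult_left_mono) auto
    also have "\<dots> = p * p ^ j * (1 - p) ^ (Suc (m - i) + n)"
      by (simp add: power_add mult_ac)
    also have "Suc (m - i) + n = m - j" using that n by auto
    finally show ?thesis by (simp add: w_def mult_ac)
  qed
  have "(\<Sum>i\<le>m. real (m choose i)) = 2 ^ m"
    using choose_row_sum[of m] by (metis of_nat_numeral of_nat_power of_nat_sum)
  moreover have "(\<Sum>i\<le>m. real (m choose i)) =
    (\<Sum>i\<in>{..j}. real (m choose i)) + (\<Sum>i\<in>{j<..m}. real (m choose i))"
    using j(1) by (subst sum.union_disjoint[symmetric]) (auto intro!: sum.cong)
  \<comment> \<open>Index 0 always lies in the head, which saves the 1 in
    \<open>2 ^ m - 1\<close>.\<close>
  moreover have "(\<Sum>i\<in>{..j}. real (m choose i)) \<ge> real (m choose 0)"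
    by (rule member_le_sum) auto
  ultimately have choose_tail: "(\<Sum>i\<in>{j<..m}. real (m choose i)) \<le> 2 ^ m - 1"
    by simp
  define T where "T = (\<Sum>i\<in>{j<..m}. of_int (c i) * w i)"
  have "(1 - p) * \<bar>T\<bar> \<le> (1 - p) * (\<Sum>i\<in>{j<..m}. real (m choose i) * w i)"
    unfolding T_def
  proof (intro mult_left_mono order.trans[OF sum_abs] sum_mono)
    fix i assume "i \<in> {j<..m}"
    then have "real_of_int \<bar>c i\<bar> \<le> real (m choose i)" using bound[of i] by simp
    then show "\<bar>of_int (c i) * w i\<bar> \<le> real (m choose i) * w i"
      using w_pos[of i] by (simp add: abs_mult)
  qed (use p in simp)
  also have "\<dots> = (\<Sum>i\<in>{j<..m}. real (m choose i) * ((1 - p) * w i))"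
    by (simp add: sum_distrib_left mult_ac)
  also have "\<dots> \<le> (\<Sum>i\<in>{j<..m}. real (m choose i) * (p * w j))"
    by (intro sum_mono mult_left_mono tail_w) auto
  also have "\<dots> = (\<Sum>i\<in>{j<..m}. real (m choose i)) * (p * w j)"
    by (simp add: sum_distrib_right)
  also have "\<dots> \<le> (2 ^ m - 1) * (p * w j)"
    using choose_tail p w_pos[of j] by (intro mult_right_mono) auto
  also have "\<dots> < (1 - p) * w j"
  proof -
    have "(2 ^ m - 1) * p < 1 - p" using p by (simp add: field_simps)
    then show ?thesis using w_pos[of j] by simp
  qed
  finally have T: "\<bar>T\<bar> < w j" using p by simp
  have "(\<Sum>i\<le>m. of_int (c i) * w i) = (\<Sum>i\<in>{j..m}. of_int (c i) * w i)"
    using j(3) by (intro sum.mono_neutral_right) (auto simp: not_le)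
  also have "\<dots> = of_int (c j) * w j + T"
    unfolding T_def using j(1) by (simp add: sum.head)
  finally have eq: "(\<Sum>i\<le>m. of_int (c i) * w i) = of_int (c j) * w j + T" .
  show ?thesis
  proof (cases "c j > 0")
    case True
    then have "1 * w j \<le> of_int (c j) * w j" using w_pos[of j] by (intro mult_right_mono) auto
    then have "of_int (c j) * w j + T > 0" using T by linarith
    then show ?thesis using True eq by (simp add: w_def)
  next
    case False
    then have "of_int (c j) * w j \<le> (- 1) * w j"
      using j(2) w_pos[of j] by (intro mult_right_mono) linarith+
    then have "of_int (c j) * w j + T < 0" using T by linarith
    then show ?thesis using False j(2) eq by (simp add: w_def)
  qed
qed

section \<open>The path protocol\<close>

text \<open>Induction in strides of two: each stride gains at least 1, and an odd leftover step
  accounts for the final \<open>+ 1\<close>.\<close>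

lemma length_forward_le:
  fixes f :: "nat \<Rightarrow> nat"
  assumes mono: "\<And>i. i < n \<Longrightarrow> f i \<le> f (Suc i)"
    and strict: "\<And>i. Suc i < n \<Longrightarrow> f i < f (Suc (Suc i))"
  shows "n \<le> 2 * (f n - f 0) + 1"
proof -
  \<comment> \<open>The second conjunct keeps the natural subtraction from truncating.\<close>
  have "n \<le> 2 * (f n - f 0) + 1 \<and> f 0 \<le> f n"
    using assms
  proof (induction n rule: less_induct)
    case (less n)
    consider "n = 0" | "n = 1" | l where "n = Suc (Suc l)"
      by (metis One_nat_def nat.exhaust)
    then show ?case
    proof cases
      case 3
      have "l \<le> 2 * (f l - f 0) + 1 \<and> f 0 \<le> f l"
        using less 3 by simp
      then show ?thesis using less.prems(2)[of l] 3 by auto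
    qed (use less.prems(1)[of 0] in auto)
  qed
  then show ?thesis ..
qed

lemma slow_steps:
  fixes f :: "nat \<Rightarrow> nat"
  assumes "\<And>i. i < n \<Longrightarrow> f (Suc i) \<le> Suc (f i)" "i \<le> j" "j \<le> n"
  shows "f j \<le> f i + (j - i)"
  using assms(2,3)
proof (induction j rule: dec_induct)
  case (step j)
  then show ?case using assms(1)[of j] by auto
qed simp

lemma finite_walks_bounded:
  assumes "finite V"
  shows "finite {xs \<in> walks V E s r. walk_length xs \<le> n}"
  by (rule finite_subset[OF _ finite_lists_length_le[OF assms, of "Suc n"]])
    (auto simp: walks_def walk_length_def)

lemma walk_hop_dist_step:
  assumes "simple_graph V E" "xs \<in> walks V E s r" "i < walk_length xs"
  shows "hop_dist V E s (xs ! Suc i) \<le> Suc (hop_dist V E s (xs ! i))"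
  using assms by (intro hop_dist_step) (auto simp: walks_def walk_length_def successively_conv_nth)

lemma walk_ends:
  assumes "xs \<in> walks V E s r"
  shows "xs ! 0 = s" "xs ! walk_length xs = r" "length xs = Suc (walk_length xs)"
  using assms by (auto simp: walks_def walk_length_def hd_conv_nth last_conv_nth)

text \<open>A path of length at most \<open>k + 1\<close> has room for a single step that does not increase the
  distance from \<open>s\<close>, and that step keeps the distance. So distances never decrease along a walk
  following these instructions, and they increase within any two steps.\<close>

lemma path_protocol_forward:
  assumes G: "simple_graph V E" "s \<in> V" and k: "graph_dist V E s r = enat k"
    and uvw: "(u, v, w) \<in> path_protocol V E s r (k + 1)"
  defines "h \<equiv> hop_dist V E s"
  shows "h u \<le> h v" "h v \<le> h w" "h u < h w"
proof -
  obtain xs where xs: "xs \<in> paths V E s r" "walk_length xs \<le> k + 1" "(u, v, w) \<in> triples xs"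
    using uvw by (auto simp: path_protocol_def)
  then have walk: "xs \<in> walks V E s r" by (simp add: paths_def)
  define n where "n = walk_length xs"
  define f where "f = (\<lambda>i. h (xs ! i))"
  note ends = walk_ends[OF walk]
  obtain i where i: "Suc (Suc i) < length xs" "u = xs ! i" "v = xs ! Suc i" "w = xs ! Suc (Suc i)"
    using xs(3) unfolding triples_conv_nth by auto
  then have i': "Suc (Suc i) \<le> n" using ends by (simp add: n_def)
  have "f 0 = 0" "f n = k"
    using ends G k by (auto simp: f_def h_def n_def hop_dist_sender hop_dist_receiver)
  have slow: "f b \<le> f a + (b - a)" if "a \<le> b" "b \<le> n" for a b
    using that walk_hop_dist_step[OF G(1) walk] unfolding f_def h_def n_def
    by (intro slow_steps) auto
  have "n \<le> k + 1" using xs(2) by (simp add: n_def)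
  have "f i \<le> i" "f (Suc i) \<le> Suc i" "k \<le> f (Suc i) + (n - Suc i)"
    "k \<le> f (Suc (Suc i)) + (n - Suc (Suc i))"
    using slow[of 0 i] slow[of 0 "Suc i"] slow[of "Suc i" n] slow[of "Suc (Suc i)" n]
      i' \<open>f 0 = 0\<close> \<open>f n = k\<close> by auto
  then show "h u \<le> h v" "h v \<le> h w" "h u < h w"
    using i i' \<open>n \<le> k + 1\<close> by (auto simp: f_def)
qed

text \<open>Along a walk of this protocol the distance from \<open>s\<close> goes from 0 to
  \<open>k\<close> and gains at least 1 in any two steps, so the length is at most
  \<open>2 * k + 1\<close>.\<close>

lemma finite_protocol_path_protocol:
  assumes G: "simple_graph V E" "s \<in> V" and k: "graph_dist V E s r = enat k"
  shows "finite_protocol V E s r (path_protocol V E s r (k + 1))"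
  unfolding finite_protocol_def protocol_def
proof
  show "path_protocol V E s r (k + 1) \<subseteq> instructions E"
    unfolding path_protocol_def using path_triples by fastforce
  define h where "h = hop_dist V E s"
  have "walk_length xs \<le> 2 * k + 1"
    if "xs \<in> protocol_walks V E s r (path_protocol V E s r (k + 1))" for xs
  proof -
    have xs: "xs \<in> walks V E s r" "triples xs \<subseteq> path_protocol V E s r (k + 1)"
      using that by (auto simp: protocol_walks_def)
    define n where "n = walk_length xs"
    note ends = walk_ends[OF xs(1)]
    have fwd: "h (xs ! i) \<le> h (xs ! Suc i)" "h (xs ! Suc i) \<le> h (xs ! Suc (Suc i))"
      "h (xs ! i) < h (xs ! Suc (Suc i))" if "Suc i < n" for i
    proof -
      have "(xs ! i, xs ! Suc i, xs ! Suc (Suc i)) \<in> triples xs"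
        using that ends unfolding triples_conv_nth n_def by auto
      then show "h (xs ! i) \<le> h (xs ! Suc i)" "h (xs ! Suc i) \<le> h (xs ! Suc (Suc i))"
        "h (xs ! i) < h (xs ! Suc (Suc i))"
        using path_protocol_forward[OF G k] xs(2) unfolding h_def by blast+
    qed
    have "h (xs ! i) \<le> h (xs ! Suc i)" if "i < n" for i
    \<comment> \<open>A single edge carries no instruction, but it starts at distance 0.\<close>
    proof (cases "n = 1")
      case True
      then show ?thesis using that ends G by (simp add: h_def hop_dist_sender)
    next
      case False
      \<comment> \<open>Every step but the last opens a triple; the last one closes the triple that
        starts at \<open>i - 1\<close>.\<close>
      then show ?thesis using that fwd(1)[of i] fwd(2)[of "i - 1"] by (cases i) auto
    qed
    then have "n \<le> 2 * (h (xs ! n) - h (xs ! 0)) + 1"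
      using fwd(3) by (intro length_forward_le) auto
    then show ?thesis
      using ends hop_dist_receiver[OF k] by (simp add: n_def h_def)
  qed
  then show "finite (protocol_walks V E s r (path_protocol V E s r (k + 1)))"
    using G(1) finite_walks_bounded[of V E s r "2 * k + 1"]
    by (auto simp: simple_graph_def protocol_walks_def elim!: finite_subset[rotated])
qed

section \<open>Small connecting edge sets\<close>

text \<open>Each protocol walk contains a path on its own edges, so no protocol connects more edge
  sets than all paths do.\<close>

lemma connecting_sets_protocol_subset:
  "connecting_sets E (protocol_walks V E s r A) i \<subseteq> connecting_sets E (paths V E s r) i"
  unfolding connecting_sets_def protocol_walks_def using walk_contains_path by fastforce

text \<open>A path inside a set of \<open>i\<close> edges has length at most \<open>l\<close>, so
  all its instructions are available: on small sets the upper bound is attained.\<close>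

lemma connecting_sets_path_protocol:
  assumes "finite E" "i \<le> l"
  shows "connecting_sets E (protocol_walks V E s r (path_protocol V E s r l)) i =
    connecting_sets E (paths V E s r) i"
proof
  show "connecting_sets E (paths V E s r) i \<subseteq>
    connecting_sets E (protocol_walks V E s r (path_protocol V E s r l)) i"
  proof
    fix F assume "F \<in> connecting_sets E (paths V E s r) i"
    then obtain xs where F: "F \<subseteq> E" "card F = i" and xs: "xs \<in> paths V E s r" "walk_edges xs \<subseteq> F"
      by (auto simp: connecting_sets_def)
    have "walk_length xs = card (walk_edges xs)"
      using xs by (simp add: paths_def card_path_edges)
    also have "\<dots> \<le> l"
      using card_mono[OF finite_subset[OF F(1) assms(1)] xs(2)] F(2) assms(2) by simp
    finally have "xs \<in> protocol_walks V E s r (path_protocol V E s r l)"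
      using xs(1) by (auto simp: protocol_walks_def path_protocol_def paths_def)
    then show "F \<in> connecting_sets E (protocol_walks V E s r (path_protocol V E s r l)) i"
      using F xs by (auto simp: connecting_sets_def)
  qed
qed (rule connecting_sets_protocol_subset)

text \<open>The distance climbs from 0 to \<open>k\<close> in \<open>k\<close> steps of at most 1,
  which leaves no slack.\<close>

lemma shortest_path_hop_dist:
  assumes G: "simple_graph V E" "s \<in> V" and k: "graph_dist V E s r = enat k"
    and xs: "xs \<in> walks V E s r" "walk_length xs = k" and i: "i \<le> k"
  shows "hop_dist V E s (xs ! i) = i"
proof -
  have slow: "hop_dist V E s (xs ! b) \<le> hop_dist V E s (xs ! a) + (b - a)" if "a \<le> b" "b \<le> k" for a b
    using that walk_hop_dist_step[OF G(1) xs(1)] xs(2)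
    by (intro slow_steps[where f = "\<lambda>i. hop_dist V E s (xs ! i)"]) auto
  show ?thesis
    using slow[of 0 i] slow[of i k] i walk_ends[OF xs(1)] xs(2)
      hop_dist_sender[OF G(2), of E] hop_dist_receiver[OF k] by auto
qed

text \<open>An inner vertex of a shortest path that the other one does not visit at the same distance is not
  visited by it at all, so both incident edges are missing there.\<close>

lemma shortest_paths_differ:
  assumes G: "simple_graph V E" "s \<in> V" and k: "graph_dist V E s r = enat k"
    and xs: "xs \<in> paths V E s r" "walk_length xs = k"
    and ys: "ys \<in> paths V E s r" "walk_length ys = k"
    and sub: "walk_edges xs \<subseteq> insert e (walk_edges ys)"
  shows "xs = ys"
proof (rule ccontr)
  assume "xs \<noteq> ys"
  have w: "xs \<in> walks V E s r" "ys \<in> walks V E s r" and d: "distinct xs"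
    using xs ys by (auto simp: paths_def)
  note ends = walk_ends[OF w(1)] walk_ends[OF w(2)]
  obtain i where i: "i \<le> k" "xs ! i \<noteq> ys ! i"
    using \<open>xs \<noteq> ys\<close> ends xs(2) ys(2) nth_equalityI[of xs ys] by (metis less_Suc_eq_le)
  have "i \<noteq> 0" "i \<noteq> k" using i ends xs(2) ys(2) by metis+
  then obtain j where j: "i = Suc j" "Suc i \<le> k" using i(1) by (cases i) auto
  \<comment> \<open>Distances reveal positions: equality would force \<open>l = i\<close>.\<close>
  have "xs ! i \<noteq> ys ! l" if "l \<le> k" for l
    using shortest_path_hop_dist[OF G k w(1) xs(2) i(1)]
      shortest_path_hop_dist[OF G k w(2) ys(2) that] i(2) by auto
  then have "xs ! i \<noteq> ys ! l" "xs ! i \<noteq> ys ! Suc l" if "l < k" for l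
    using that by auto
  then have "f \<notin> walk_edges ys" if "xs ! i \<in> f" for f
    using that ys(2) by (auto simp: walk_edges_conv_nth)
  moreover have "{xs ! j, xs ! i} \<in> walk_edges xs" "{xs ! i, xs ! Suc i} \<in> walk_edges xs"
    using j xs(2) by (auto simp: walk_edges_conv_nth)
  \<comment> \<open>Only \<open>e\<close> may be missing from \<open>ys\<close>, so both edges of
    \<open>xs\<close> at this vertex would be \<open>e\<close>.\<close>
  ultimately have "{xs ! j, xs ! i} = e" "{xs ! i, xs ! Suc i} = e"
    using sub by auto
  then have "{xs ! j, xs ! i} = {xs ! i, xs ! Suc i}" by simp
  then show False
    using d j xs(2) ends by (auto simp: doubleton_eq_iff nth_eq_iff_index_eq)
qed

text \<open>Common core of the counts below: sizes confine the length to the range from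
  \<open>k\<close> to \<open>i\<close>, and a path of length \<open>i\<close> exhausts
  \<open>F\<close>.\<close>

lemma path_in_connecting_set:
  assumes k: "graph_dist V E s r = enat k" and E: "finite E"
    and F: "F \<in> connecting_sets E (paths V E s r) i"
  obtains xs where "xs \<in> paths V E s r" "walk_edges xs \<subseteq> F" "k \<le> walk_length xs"
    "walk_length xs \<le> i" "walk_length xs = i \<Longrightarrow> F = walk_edges xs"
proof -
  obtain xs where xs: "xs \<in> paths V E s r" "walk_edges xs \<subseteq> F" and "F \<subseteq> E" "card F = i"
    using F by (auto simp: connecting_sets_def)
  have "finite F" using \<open>F \<subseteq> E\<close> E by (rule finite_subset)
  have card: "card (walk_edges xs) = walk_length xs"
    using xs(1) by (simp add: paths_def card_path_edges)
  show ?thesis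
  proof (rule that[OF xs])
    show "k \<le> walk_length xs" using graph_dist_le[OF k] xs(1) by (simp add: paths_def)
    show "walk_length xs \<le> i"
      using card_mono[OF \<open>finite F\<close> xs(2)] card \<open>card F = i\<close> by simp
    show "F = walk_edges xs" if "walk_length xs = i"
      using card_subset_eq[OF \<open>finite F\<close> xs(2)] card \<open>card F = i\<close> that by simp
  qed
qed

lemma connecting_sets_below_dist:
  assumes "graph_dist V E s r = enat k" "finite E" "i < k"
  shows "connecting_sets E (paths V E s r) i = {}"
proof -
  have False if "F \<in> connecting_sets E (paths V E s r) i" for F
    by (rule path_in_connecting_set[OF assms(1,2) that]) (use assms(3) in linarith)
  then show ?thesis by blast
qed

lemma path_edges_in_connecting_sets:
  assumes "xs \<in> paths V E s r"
  shows "walk_edges xs \<in> connecting_sets E (paths V E s r) (walk_length xs)"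
  using assms walk_edges_subset[of xs V E s r]
  by (auto simp: connecting_sets_def paths_def card_path_edges)

text \<open>Lets paths be counted by their edge sets.\<close>

lemma inj_on_walk_edges: "inj_on walk_edges (paths V E s r)"
  by (rule inj_onI) (metis path_edges_subset_imp_eq order_refl)

lemma finite_paths_of_length:
  assumes "simple_graph V E"
  shows "finite {xs \<in> paths V E s r. walk_length xs = l}"
  using assms finite_walks_bounded[of V E s r l]
  by (auto simp: simple_graph_def paths_def elim!: finite_subset[rotated])

lemma card_connecting_sets_dist:
  assumes G: "simple_graph V E" and k: "graph_dist V E s r = enat k"
  shows "card (connecting_sets E (paths V E s r) k) = num_paths V E s r k"
proof -
  have "connecting_sets E (paths V E s r) k = walk_edges ` {xs \<in> paths V E s r. walk_length xs = k}"
  proof (intro equalityI subsetI)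
    fix F assume "F \<in> connecting_sets E (paths V E s r) k"
    then obtain xs where "xs \<in> paths V E s r" "walk_length xs = k" "F = walk_edges xs"
      using path_in_connecting_set[OF k finite_graph_edges[OF G]] by (metis le_antisym)
    then show "F \<in> walk_edges ` {xs \<in> paths V E s r. walk_length xs = k}" by blast
  qed (auto dest: path_edges_in_connecting_sets)
  moreover have "inj_on walk_edges {xs \<in> paths V E s r. walk_length xs = k}"
    by (rule inj_on_subset[OF inj_on_walk_edges]) auto
  ultimately show ?thesis
    by (simp add: num_paths_def card_image)
qed

text \<open>Such a set is a shortest path plus one spare edge, or a path of length
  \<open>k + 1\<close>. The kinds do not overlap, as no path contains the edges of another; and a
  set of the first kind arises only once, as two shortest paths never differ by a single
  edge.\<close>

lemma card_connecting_sets_Suc_dist: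
  assumes G: "simple_graph V E" "s \<in> V" and k: "graph_dist V E s r = enat k"
  shows "card (connecting_sets E (paths V E s r) (Suc k)) =
    num_paths V E s r k * (card E - k) + num_paths V E s r (Suc k)"
proof -
  define P where "P = (\<lambda>l. {xs \<in> paths V E s r. walk_length xs = l})"
  define Q where "Q = (SIGMA xs:P k. E - walk_edges xs)"
  define ext where "ext = (\<lambda>(xs :: 'a list, e). insert e (walk_edges xs))"
  have finE: "finite E" using G(1) by (rule finite_graph_edges)
  have finP: "finite (P l)" for l unfolding P_def using G(1) by (rule finite_paths_of_length)
  have sub: "walk_edges xs \<subseteq> E" "card (walk_edges xs) = l" if "xs \<in> P l" for xs l
    using that walk_edges_subset[of xs V E s r] by (auto simp: P_def paths_def card_path_edges)
  have "connecting_sets E (paths V E s r) (Suc k) = ext ` Q \<union> walk_edges ` P (Suc k)"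
  proof (intro equalityI subsetI)
    fix F assume F: "F \<in> connecting_sets E (paths V E s r) (Suc k)"
    then have F': "F \<subseteq> E" "card F = Suc k" by (auto simp: connecting_sets_def)
    obtain xs where xs: "xs \<in> paths V E s r" "walk_edges xs \<subseteq> F" "k \<le> walk_length xs"
      "walk_length xs \<le> Suc k" "walk_length xs = Suc k \<Longrightarrow> F = walk_edges xs"
      using path_in_connecting_set[OF k finE F] by blast
    show "F \<in> ext ` Q \<union> walk_edges ` P (Suc k)"
    proof (cases "walk_length xs = k")
      case True
      have "card (F - walk_edges xs) = 1"
        using xs F' True by (simp add: card_Diff_subset finite_walk_edges card_path_edges paths_def)
      then obtain e where e: "F - walk_edges xs = {e}" by (auto simp: card_1_singleton_iff)
      then have "F = ext (xs, e)" "(xs, e) \<in> Q"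
        using xs F' True by (auto simp: ext_def Q_def P_def)
      then show ?thesis by blast
    next
      case False
      then show ?thesis using xs by (auto simp: P_def)
    qed
  next
    fix F assume "F \<in> ext ` Q \<union> walk_edges ` P (Suc k)"
    then consider xs e where "F = insert e (walk_edges xs)" "xs \<in> P k" "e \<in> E" "e \<notin> walk_edges xs"
      | xs where "F = walk_edges xs" "xs \<in> P (Suc k)"
      by (auto simp: ext_def Q_def)
    then show "F \<in> connecting_sets E (paths V E s r) (Suc k)"
    proof cases
      case 1
      then show ?thesis
        using sub[of xs k] by (auto simp: connecting_sets_def finite_walk_edges P_def)
    next
      case 2
      then show ?thesis using path_edges_in_connecting_sets[of xs V E s r] by (simp add: P_def)
    qed
  qed
  moreover have "ext ` Q \<inter> walk_edges ` P (Suc k) = {}"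
  proof (rule ccontr)
    assume "ext ` Q \<inter> walk_edges ` P (Suc k) \<noteq> {}"
    then obtain xs e ys where "xs \<in> P k" "ys \<in> P (Suc k)" "insert e (walk_edges xs) = walk_edges ys"
      by (auto simp: ext_def Q_def)
    moreover from this have "walk_edges xs \<subseteq> walk_edges ys" by blast
    ultimately show False
      using path_edges_subset_imp_eq[of ys V E s r xs] by (simp add: P_def)
  qed
  moreover have "inj_on ext Q"
  proof (rule inj_onI)
    fix a b assume "a \<in> Q" "b \<in> Q" "ext a = ext b"
    then obtain xs e ys f where ab: "a = (xs, e)" "b = (ys, f)" "xs \<in> P k" "ys \<in> P k"
      "e \<notin> walk_edges xs" "f \<notin> walk_edges ys"
      and eq: "insert e (walk_edges xs) = insert f (walk_edges ys)"
      by (auto simp: Q_def ext_def)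
    have "walk_edges xs \<subseteq> insert f (walk_edges ys)" using eq by blast
    then have "xs = ys"
      using shortest_paths_differ[OF G k] ab(3,4) by (auto simp: P_def)
    \<comment> \<open>Both spare edges lie outside the same path, so they agree.\<close>
    then show "a = b" using ab eq by blast
  qed
  moreover have "inj_on walk_edges (P (Suc k))"
    by (rule inj_on_subset[OF inj_on_walk_edges]) (auto simp: P_def)
  moreover have "card Q = card (P k) * (card E - k)"
  proof -
    have "card Q = (\<Sum>xs\<in>P k. card (E - walk_edges xs))"
      unfolding Q_def using finP finE by (intro card_SigmaI) auto
    also have "\<dots> = (\<Sum>xs\<in>P k. card E - k)"
      using sub by (intro sum.cong) (simp_all add: card_Diff_subset finite_walk_edges)
    finally show ?thesis by simp
  qed
  moreover have "finite Q" unfolding Q_def using finP finE by (intro finite_SigmaI) auto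
  ultimately show ?thesis
    using finP by (simp add: card_Un_disjoint card_image num_paths_def P_def)
qed

section \<open>The first two terms\<close>

text \<open>Only the order of the error matters, so a crude square replaces the exact binomial
  term.\<close>

lemma power_one_minus_bounds:
  fixes p :: real
  assumes "0 \<le> p" "p \<le> 1"
  shows "1 - real n * p \<le> (1 - p) ^ n" "(1 - p) ^ n \<le> 1 - real n * p + (real n * p) ^ 2"
proof -
  show lower: "1 - real n * p \<le> (1 - p) ^ n" for n
    using Bernoulli_inequality[of "- p" n] assms by simp
  show "(1 - p) ^ n \<le> 1 - real n * p + (real n * p) ^ 2"
  proof (induction n)
    case (Suc n)
    have "(1 - p) ^ Suc n \<le> (1 - p) * (1 - real n * p + (real n * p) ^ 2)"
      using Suc assms by (simp add: mult_left_mono)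
    also have "\<dots> = 1 - real (Suc n) * p + (real (n + n ^ 2) * p ^ 2 - real n ^ 2 * p ^ 3)"
      by (simp add: algebra_simps power2_eq_square power3_eq_cube)
    also have "\<dots> \<le> 1 - real (Suc n) * p + (real (Suc n) * p) ^ 2"
    proof -
      have "0 \<le> real n ^ 2 * p ^ 3" "0 \<le> real (n + 1) * p ^ 2" using assms by auto
      moreover have "(real (Suc n) * p) ^ 2 = real (n + n ^ 2) * p ^ 2 + real (n + 1) * p ^ 2"
        by (simp add: algebra_simps power2_eq_square)
      ultimately show ?thesis by linarith
    qed
    finally show ?case .
  qed simp
qed

text \<open>Index \<open>k\<close> is expanded to first order in \<open>p\<close> and index
  \<open>Suc k\<close> to order zero; all later terms are already of order
  \<open>p ^ (k + 2)\<close>. Where \<open>m - k\<close> truncates, \<open>high\<close> makes the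
  coefficients vanish.\<close>

lemma two_term_expansion:
  fixes N :: "nat \<Rightarrow> real"
  assumes low: "\<And>i. i < k \<Longrightarrow> N i = 0" and high: "\<And>i. m < i \<Longrightarrow> N i = 0"
  shows "(\<lambda>p. (\<Sum>i\<le>m. N i * (p ^ i * (1 - p) ^ (m - i)))
      - (N k * p ^ k + (N (Suc k) - N k * real (m - k)) * p ^ Suc k))
    \<in> O[at_right 0](\<lambda>p. p ^ (k + 2))"
proof -
  define R where "R = {k + 2..m}"
  have split: "(\<Sum>i\<le>m. N i * (p ^ i * (1 - p) ^ (m - i)))
      - (N k * p ^ k + (N (Suc k) - N k * real (m - k)) * p ^ Suc k) =
      N k * (p ^ k * ((1 - p) ^ (m - k) - 1 + real (m - k) * p)) +
      N (Suc k) * (p ^ Suc k * ((1 - p) ^ (m - Suc k) - 1)) +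
      (\<Sum>i\<in>R. N i * (p ^ i * (1 - p) ^ (m - i)))" for p
  proof -
    define t where "t = (\<lambda>i. N i * (p ^ i * (1 - p) ^ (m - i)))"
    \<comment> \<open>\<open>k\<close> or \<open>Suc k\<close> may exceed \<open>m\<close>; such
      extra terms are zero by \<open>high\<close>.\<close>
    have "sum t {..m} = sum t ({k, Suc k} \<union> R)"
      using low high
      by (intro sum.mono_neutral_cong) (auto simp: t_def R_def not_less_eq_eq le_Suc_eq not_le)
    also have "\<dots> = t k + t (Suc k) + sum t R"
      by (subst sum.union_disjoint) (auto simp: R_def)
    finally show ?thesis by (simp add: t_def algebra_simps)
  qed
  have ev: "eventually (\<lambda>p::real. 0 < p \<and> p < 1) (at_right 0)"
    using eventually_at_right_real[of "0::real" 1] by simp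
  have "(\<lambda>p. p ^ k * ((1 - p) ^ (m - k) - 1 + real (m - k) * p))
      \<in> O[at_right 0](\<lambda>p::real. p ^ (k + 2))"
  proof (intro bigoI[where c = "real (m - k) ^ 2"] eventually_mono[OF ev])
    fix p :: real assume p: "0 < p \<and> p < 1"
    have "\<bar>(1 - p) ^ (m - k) - 1 + real (m - k) * p\<bar> \<le> (real (m - k) * p) ^ 2"
      using power_one_minus_bounds[of p "m - k"] p by (simp add: abs_le_iff)
    then have "p ^ k * \<bar>(1 - p) ^ (m - k) - 1 + real (m - k) * p\<bar> \<le> p ^ k * (real (m - k) * p) ^ 2"
      using p by (intro mult_left_mono) auto
    then show "norm (p ^ k * ((1 - p) ^ (m - k) - 1 + real (m - k) * p)) \<le>
        real (m - k) ^ 2 * norm (p ^ (k + 2))"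
      using p by (simp add: abs_mult power_mult_distrib power_add power2_eq_square mult_ac)
  qed
  moreover have "(\<lambda>p. p ^ Suc k * ((1 - p) ^ (m - Suc k) - 1))
      \<in> O[at_right 0](\<lambda>p::real. p ^ (k + 2))"
  proof (intro bigoI[where c = "real (m - Suc k)"] eventually_mono[OF ev])
    fix p :: real assume p: "0 < p \<and> p < 1"
    have "(1 - p) ^ (m - Suc k) \<le> 1" using p by (intro power_le_one) auto
    then have "\<bar>(1 - p) ^ (m - Suc k) - 1\<bar> \<le> real (m - Suc k) * p"
      using power_one_minus_bounds(1)[of p "m - Suc k"] p by (simp add: abs_le_iff)
    then have "p ^ Suc k * \<bar>(1 - p) ^ (m - Suc k) - 1\<bar> \<le> p ^ Suc k * (real (m - Suc k) * p)"
      using p by (intro mult_left_mono) auto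
    then show "norm (p ^ Suc k * ((1 - p) ^ (m - Suc k) - 1)) \<le> real (m - Suc k) * norm (p ^ (k + 2))"
      using p by (simp add: abs_mult mult_ac)
  qed
  moreover have "(\<lambda>p. N i * (p ^ i * (1 - p) ^ (m - i))) \<in> O[at_right 0](\<lambda>p. p ^ (k + 2))"
    if "i \<in> R" for i
  proof (intro bigoI[where c = "\<bar>N i\<bar>"] eventually_mono[OF ev])
    fix p :: real assume p: "0 < p \<and> p < 1"
    have "p ^ i * (1 - p) ^ (m - i) \<le> p ^ (k + 2) * 1"
      using p that by (intro mult_mono power_decreasing power_le_one) (auto simp: R_def)
    then show "norm (N i * (p ^ i * (1 - p) ^ (m - i))) \<le> \<bar>N i\<bar> * norm (p ^ (k + 2))"
      using p by (auto simp: abs_mult intro!: mult_left_mono)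
  qed
  ultimately show ?thesis
    unfolding split by (intro sum_in_bigo big_sum_in_bigo) auto
qed

section \<open>Comparing protocols\<close>

text \<open>Both counts lie between 0 and \<open>card E choose i\<close>, so their difference is an
  integer within the bound of \<open>sgn_leading_coeff\<close>. The right-hand side does not depend
  on \<open>p\<close>.\<close>

lemma sgn_rho_diff:
  fixes s r :: 'a
  assumes G: "simple_graph V E"
  defines "N \<equiv> \<lambda>A i. card (connecting_sets E (protocol_walks V E s r A) i)"
  assumes j: "j \<le> card E" "N A j \<noteq> N B j" "\<And>i. i < j \<Longrightarrow> N A i = N B i"
    and p: "0 < p" "p < 1" "p < 1 / 2 ^ card E"
  shows "sgn (rho V E s r A p - rho V E s r B p) = sgn (real (N A j) - real (N B j))"
proof -
  define c where "c = (\<lambda>i. int (N A i) - int (N B i))"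
  have "rho V E s r A p - rho V E s r B p =
    (\<Sum>i\<le>card E. of_int (c i) * (p ^ i * (1 - p) ^ (card E - i)))"
    using p rho_expansion[OF G, of p s r]
    by (simp add: c_def N_def left_diff_distrib sum_subtractf)
  also have "sgn \<dots> = of_int (sgn (c j))"
  proof (rule sgn_leading_coeff)
    fix i assume "i \<le> card E"
    show "\<bar>c i\<bar> \<le> int (card E choose i)"
      using card_connecting_sets_le[OF finite_graph_edges[OF G], of "protocol_walks V E s r A" i]
        card_connecting_sets_le[OF finite_graph_edges[OF G], of "protocol_walks V E s r B" i]
      by (simp add: c_def N_def)
  qed (use j p in \<open>auto simp: c_def\<close>)
  also have "\<dots> = sgn (real (N A j) - real (N B j))"
    by (simp add: c_def sgn_if)
  finally show ?thesis .
qed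

text \<open>The sign of the difference is constant on the interval; without a first differing count
  the two polynomials are equal.\<close>

lemma rho_le_transfer:
  assumes G: "simple_graph V E"
    and p: "0 < p" "p < 1" "p < 1 / 2 ^ card E" and q: "0 < q" "q < 1" "q < 1 / 2 ^ card E"
    and le: "rho V E s r B p \<le> rho V E s r A p"
  shows "rho V E s r B q \<le> rho V E s r A q"
proof -
  define N where "N = (\<lambda>A i. card (connecting_sets E (protocol_walks V E s r A) i))"
  show ?thesis
  proof (cases "\<exists>j\<le>card E. N A j \<noteq> N B j")
    case True
    then obtain j where j: "j \<le> card E" "N A j \<noteq> N B j" "\<And>i. i < j \<Longrightarrow> N A i = N B i"
      using exists_least_iff[of "\<lambda>j. j \<le> card E \<and> N A j \<noteq> N B j"] by (meson le_trans less_imp_le)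
    have "sgn (rho V E s r A q - rho V E s r B q) = sgn (rho V E s r A p - rho V E s r B p)"
      using sgn_rho_diff[OF G j[unfolded N_def] p] sgn_rho_diff[OF G j[unfolded N_def] q] by simp
    then show ?thesis using le by (simp add: sgn_if split: if_splits)
  next
    case False
    then show ?thesis using q by (simp add: N_def rho_expansion[OF G])
  qed
qed

text \<open>By the inclusions, a first difference at an index up to \<open>l\<close> would favour
  \<open>B\<close> and make \<open>B\<close> strictly better at \<open>p\<close>.\<close>

lemma connecting_sets_eq_of_rho_le:
  assumes G: "simple_graph V E"
    and p: "0 < p" "p < 1" "p < 1 / 2 ^ card E"
    and le: "rho V E s r B p \<le> rho V E s r A p"
    and sub: "\<And>i. i \<le> l \<Longrightarrow> connecting_sets E (protocol_walks V E s r A) i \<subseteq>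
      connecting_sets E (protocol_walks V E s r B) i"
    and i: "i \<le> l"
  shows "connecting_sets E (protocol_walks V E s r A) i = connecting_sets E (protocol_walks V E s r B) i"
proof (rule ccontr)
  define N where "N = (\<lambda>A i. card (connecting_sets E (protocol_walks V E s r A) i))"
  have fin: "finite (connecting_sets E (protocol_walks V E s r A) i)" for A i
    using finite_graph_edges[OF G] by (rule finite_connecting_sets)
  assume "connecting_sets E (protocol_walks V E s r A) i \<noteq>
    connecting_sets E (protocol_walks V E s r B) i"
  then have "N A i \<noteq> N B i"
    unfolding N_def using card_subset_eq[OF fin sub[OF i]] by blast
  then obtain j where j: "N A j \<noteq> N B j" "\<And>i. i < j \<Longrightarrow> N A i = N B i" and "j \<le> i"
    using exists_least_iff[of "\<lambda>i. N A i \<noteq> N B i"] by (meson leI)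
  have "N A j \<le> N B j"
    unfolding N_def using \<open>j \<le> i\<close> i by (intro card_mono[OF fin] sub) simp
  then have "N A j < N B j" using j(1) by simp
  moreover have "j \<le> card E"
  proof (rule ccontr)
    assume "\<not> j \<le> card E"
    then have "N B j = 0"
      using card_connecting_sets_le[OF finite_graph_edges[OF G], of _ j] by (simp add: N_def binomial_eq_0)
    then show False using \<open>N A j < N B j\<close> by simp
  qed
  ultimately have "sgn (rho V E s r A p - rho V E s r B p) = - 1"
    using sgn_rho_diff[OF G, of j s r A B p] j p by (simp add: N_def)
  then show False using le by (simp add: sgn_if split: if_splits)
qed

section \<open>The maximum over finite protocols\<close>

lemma finite_rho_values:
  assumes "simple_graph V E"
  shows "finite {rho V E s r A p |A. finite_protocol V E s r A}"
  by (rule finite_subset[of _ "(\<lambda>A. rho V E s r A p) ` Pow (instructions E)"])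
    (auto simp: finite_protocol_def protocol_def finite_instructions[OF assms])

lemma rho_le_rho_hat:
  assumes "simple_graph V E" "finite_protocol V E s r A"
  shows "rho V E s r A p \<le> rho_hat V E s r p"
  unfolding rho_hat_def using assms by (intro Max_ge finite_rho_values) auto

lemma rho_hat_attained:
  assumes "simple_graph V E" "finite_protocol V E s r B"
  obtains A where "finite_protocol V E s r A" "rho_hat V E s r p = rho V E s r A p"
proof -
  have "rho_hat V E s r p \<in> {rho V E s r A p |A. finite_protocol V E s r A}"
    unfolding rho_hat_def using assms by (intro Max_in finite_rho_values) auto
  then show ?thesis using that by blast
qed

theorem theorem8p1:
  fixes V :: "'a set" and E :: "'a set set" and s r :: 'a
    and k m :: nat and A0 :: "('a \<times> 'a \<times> 'a) set"
  assumes "simple_graph V E" and "s \<in> V" and "r \<in> V"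
    and "m = card E"
    and "graph_dist V E s r = enat k"
    and "protocol E A0"
    and "\<exists>\<epsilon>>0. \<forall>p. 0 < p \<and> p < 1 \<and> p < \<epsilon> \<longrightarrow> rho_hat V E s r p = rho V E s r A0 p"
  shows "path_protocol V E s r (k + 1) \<subseteq> A0 \<and>
    (\<forall>p. 0 < p \<and> p < 1 \<and> p < 1 / 3 ^ m \<longrightarrow> rho_hat V E s r p = rho V E s r A0 p) \<and>
    (\<lambda>p. rho V E s r A0 p
        - (real (num_paths V E s r k) * p ^ k + real (num_paths V E s r (k + 1)) * p ^ (k + 1)))
      \<in> O[at_right 0](\<lambda>p. p ^ (k + 2))"
proof (intro conjI allI impI)
  note G = assms(1) and k = assms(5)
  define B where "B = path_protocol V E s r (k + 1)"
  define W where "W = protocol_walks V E s r"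
  have finE: "finite E" using G by (rule finite_graph_edges)
  have B: "finite_protocol V E s r B"
    unfolding B_def using G assms(2) k by (rule finite_protocol_path_protocol)
  obtain \<epsilon> where \<epsilon>: "\<epsilon> > 0" "\<And>p. 0 < p \<Longrightarrow> p < 1 \<Longrightarrow> p < \<epsilon> \<Longrightarrow> rho_hat V E s r p = rho V E s r A0 p"
    using assms(7) by blast
  define q :: real where "q = 1 / 2 ^ card E"
  \<comment> \<open>A point where \<open>A0\<close> is optimal by assumption and where signs are
    governed by leading coefficients.\<close>
  define p0 where "p0 = min (q / 2) (\<epsilon> / 2)"
  have "0 < q" "q \<le> 1" by (simp_all add: q_def)
  then have "0 < p0" "p0 < 1" "p0 < q" "p0 < \<epsilon>"
    using \<epsilon>(1) by (auto simp: p0_def min_less_iff_disj)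
  then have p0: "0 < p0" "p0 < 1" "p0 < 1 / 2 ^ card E" "p0 < \<epsilon>"
    by (simp_all add: q_def)
  have opt0: "rho_hat V E s r p0 = rho V E s r A0 p0" using \<epsilon>(2) p0 by blast
  have small: "connecting_sets E (W A0) i = connecting_sets E (paths V E s r) i" if "i \<le> k + 1" for i
  proof -
    have "connecting_sets E (W A0) i = connecting_sets E (W B) i"
      unfolding W_def
    proof (rule connecting_sets_eq_of_rho_le[OF G p0(1-3)])
      show "rho V E s r B p0 \<le> rho V E s r A0 p0"
        using rho_le_rho_hat[OF G B, of p0] opt0 by simp
      show "i \<le> k + 1" by fact
      show "connecting_sets E (protocol_walks V E s r A0) i \<subseteq>
          connecting_sets E (protocol_walks V E s r B) i" if "i \<le> k + 1" for i
        unfolding B_def connecting_sets_path_protocol[OF finE that]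
        by (rule connecting_sets_protocol_subset)
    qed
    then show ?thesis
      unfolding W_def B_def connecting_sets_path_protocol[OF finE that] .
  qed

  show "path_protocol V E s r (k + 1) \<subseteq> A0"
    unfolding path_protocol_def
  proof (intro UN_least, clarify)
    fix xs u v w
    assume xs: "xs \<in> paths V E s r" "walk_length xs \<le> k + 1" and t: "(u, v, w) \<in> triples xs"
    \<comment> \<open>Some walk of \<open>A0\<close> runs inside the edges of \<open>xs\<close>;
      having no U-turn, it is \<open>xs\<close> itself.\<close>
    have "walk_edges xs \<in> connecting_sets E (W A0) (walk_length xs)"
      using path_edges_in_connecting_sets[OF xs(1)] small[OF xs(2)] by simp
    then obtain ys where ys: "ys \<in> W A0" "walk_edges ys \<subseteq> walk_edges xs"
      by (auto simp: connecting_sets_def)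
    then have "ys = xs"
      using walk_within_path[OF xs(1)] assms(6) by (auto simp: W_def protocol_walks_def protocol_def)
    then show "(u, v, w) \<in> A0" using ys(1) t by (auto simp: W_def protocol_walks_def)
  qed

  show "rho_hat V E s r p = rho V E s r A0 p" if "0 < p \<and> p < 1 \<and> p < 1 / 3 ^ m" for p
  proof -
    have "(1::real) / 3 ^ m \<le> 1 / 2 ^ m" by (intro divide_left_mono power_mono) auto
    then have p: "0 < p" "p < 1" "p < 1 / 2 ^ card E" using that assms(4) by auto
    \<comment> \<open>A maximiser at \<open>p\<close> does not beat \<open>A0\<close> at
      \<open>p0\<close>, hence not at \<open>p\<close> either.\<close>
    obtain A where A: "finite_protocol V E s r A" "rho_hat V E s r p = rho V E s r A p"
      using rho_hat_attained[OF G B] .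
    have "rho V E s r A p0 \<le> rho V E s r A0 p0"
      using rho_le_rho_hat[OF G A(1), of p0] opt0 by simp
    then have "rho V E s r A p \<le> rho V E s r A0 p"
      by (rule rho_le_transfer[OF G p0(1-3) p])
    \<comment> \<open>\<open>A0\<close> is not known to be finite, so \<open>rho_hat\<close> does
      not bound it directly; a finite maximiser at \<open>p0\<close> ties with it there and so
      bounds it at \<open>p\<close>.\<close>
    moreover
    obtain A' where A': "finite_protocol V E s r A'" "rho_hat V E s r p0 = rho V E s r A' p0"
      using rho_hat_attained[OF G B] .
    then have "rho V E s r A0 p \<le> rho V E s r A' p"
      using opt0 by (intro rho_le_transfer[OF G p0(1-3) p]) simp
    then have "rho V E s r A0 p \<le> rho_hat V E s r p"
      using rho_le_rho_hat[OF G A'(1), of p] by simp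
    ultimately show ?thesis using A(2) by simp
  qed

  define N where "N = (\<lambda>i. real (card (connecting_sets E (W A0) i)))"
  have "N i = 0" if "i < k" for i
    using connecting_sets_below_dist[OF k finE that] small[of i] that by (simp add: N_def)
  moreover have "N i = 0" if "m < i" for i
    using card_connecting_sets_le[OF finE, of "W A0" i] that assms(4)
    by (simp add: N_def binomial_eq_0)
  ultimately have "(\<lambda>p. (\<Sum>i\<le>m. N i * (p ^ i * (1 - p) ^ (m - i)))
      - (N k * p ^ k + (N (Suc k) - N k * real (m - k)) * p ^ Suc k))
      \<in> O[at_right 0](\<lambda>p. p ^ (k + 2))"
    by (rule two_term_expansion)
  moreover have "N k = real (num_paths V E s r k)"
    using small[of k] card_connecting_sets_dist[OF G k] by (simp add: N_def)
  \<comment> \<open>\<open>N (Suc k)\<close> counts each shortest path once per spare edge; the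
    linear term of \<open>(1 - p) ^ (m - k)\<close> at index \<open>k\<close> cancels exactly
    these.\<close>
  moreover have "N (Suc k) - N k * real (m - k) = real (num_paths V E s r (k + 1))"
    using small[of k] small[of "Suc k"] card_connecting_sets_dist[OF G k]
      card_connecting_sets_Suc_dist[OF G assms(2) k] assms(4)
    by (simp add: N_def)
  ultimately have "(\<lambda>p. (\<Sum>i\<le>m. N i * (p ^ i * (1 - p) ^ (m - i)))
      - (real (num_paths V E s r k) * p ^ k + real (num_paths V E s r (k + 1)) * p ^ (k + 1)))
      \<in> O[at_right 0](\<lambda>p. p ^ (k + 2))"
    by simp
  \<comment> \<open>The expansion is valid for probabilities only, which suffices to the right of
    0.\<close>
  moreover have "eventually (\<lambda>p. rho V E s r A0 p =
      (\<Sum>i\<le>m. N i * (p ^ i * (1 - p) ^ (m - i)))) (at_right 0)"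
    by (rule eventually_mono[OF eventually_at_right_real[OF zero_less_one]])
      (auto simp: rho_expansion[OF G] N_def W_def assms(4))
  ultimately show "(\<lambda>p. rho V E s r A0 p
        - (real (num_paths V E s r k) * p ^ k + real (num_paths V E s r (k + 1)) * p ^ (k + 1)))
      \<in> O[at_right 0](\<lambda>p. p ^ (k + 2))"
    by (subst landau_o.big.in_cong) (auto elim: eventually_mono)
qed

end
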